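(* Let $a,b\in\mathbb{C}$, let $n\ge1$ be an integer, and let $\mathbf{T}_n=\mathrm{tridiag}(a,b,a)\in\mathbb{C}^{n\times n}$. Then for all $i,j\in\{1,\dots,n\}$, $$\left|\bigl(\exp(\mathbf{T}_n)\bigr)_{ij}\right|\le 2e^{\operatorname{Re}(b)}\left(\frac{|a|e}{n+1}\right)^{n+1}+e^{\operatorname{Re}(b)}\bigl(I_{|i-j|}(2|a|)+I_{i+j}(2|a|)\bigr).$$
   Context: $\mathrm{tridiag}(a,b,a)$ denotes the $n\times n$ tridiagonal Toeplitz matrix with all main diagonal entries equal to $b$, all sub-diagonal and super-diagonal entries equal to $a$, and all other entries zero. $\exp$ is the matrix exponential and the number $e$ is Euler's number. For an integer $k\ge 0$, $I_k(x)=\sum_{s=0}^{\infty}\frac{1}{s!(k+s)!}\left(\frac{x}{2}\right)^{k+2s}$ is the modified Bessel function of the first kind. *)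

theory Defs
  imports Complex_Main "Jordan_Normal_Form.Matrix"
begin

text \<open>The Toeplitz matrix with \<open>a\<close> on the sub-diagonal, \<open>b\<close> on the diagonal and \<open>c\<close> on the
  super-diagonal. Matrix entries are indexed from \<open>0\<close>.\<close>

definition tridiag :: "nat \<Rightarrow> complex \<Rightarrow> complex \<Rightarrow> complex \<Rightarrow> complex mat" where
  "tridiag n a b c = mat n n (\<lambda>(i, j).
     if i = j then b else if i = Suc j then a else if j = Suc i then c else 0)"

text \<open>The exponential series of a square matrix. The type of matrices carries no topology
  (dimensions are not part of the type), so the limit is taken entrywise.\<close>

definition mat_exp :: "complex mat \<Rightarrow> complex mat" where
  "mat_exp A = mat (dim_row A) (dim_col A) (\<lambda>(i, j).
     \<Sum>k. (inverse (fact k) \<cdot>\<^sub>m (A ^\<^sub>m k)) $$ (i, j))"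

definition bessel_I :: "nat \<Rightarrow> real \<Rightarrow> real" where
  "bessel_I k x = (\<Sum>s. 1 / (fact s * fact (k + s)) * (x / 2) ^ (k + 2 * s))"

end

theory Submission
  imports Defs
begin

text \<open>Write \<open>T = b I + a H\<close>, where \<open>H\<close> is the adjacency matrix of the path on \<open>n\<close> vertices. Since the
  two summands commute, \<open>exp T = e\<^sup>b exp (a H)\<close>. The entry \<open>(i, j)\<close> of \<open>H\<^sup>k\<close> counts the walks of
  length \<open>k\<close> from \<open>i\<close> to \<open>j\<close> that stay in the path, so it is at most the number of all \<open>k\<close>-step
  walks on \<open>\<int>\<close> with displacement \<open>i - j\<close>. The exponential generating function of these numbers is
  \<open>I\<^bsub>|i-j|\<^esub>(2x)\<close>. Hence the entry is bounded by \<open>e\<^bsup>Re b\<^esup> I\<^bsub>|i-j|\<^esub>(2|a|)\<close> alone, and the other two terms of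
  the theorem are nonnegative.\<close>

text \<open>The number of walks on the integers with \<open>k\<close> steps of +1 or -1 and
  displacement \<open>d\<close>. Taking \<open>d\<close> in \<open>int\<close> keeps the recursion
  free of boundary cases.\<close>

primrec walks :: "nat \<Rightarrow> int \<Rightarrow> nat" where
  "walks 0 d = (if d = 0 then 1 else 0)"
| "walks (Suc k) d = walks k (d - 1) + walks k (d + 1)"

lemma walks_uminus: "walks k (- d) = walks k d"
proof (induction k arbitrary: d)
  case (Suc k)
  have "walks k (- d - 1) = walks k (d + 1)" "walks k (- d + 1) = walks k (d - 1)"
    using Suc[of "d + 1"] Suc[of "d - 1"]
    by (simp_all only: minus_add_distrib minus_diff_eq) simp_all
  then show ?case by simp
qed simp

lemma walks_abs: "walks k \<bar>d\<bar> = walks k d"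
  by (simp add: abs_if walks_uminus)

lemma walks_eq_0_if_gt: "d > int k \<Longrightarrow> walks k d = 0"
  by (induction k arbitrary: d) auto

lemma walks_eq_0_if_odd: "odd (int k + d) \<Longrightarrow> walks k d = 0"
  by (induction k arbitrary: d) auto

text \<open>Choose which \<open>s\<close> of the \<open>k\<close> steps go down. The induction is
  Pascal's rule; for \<open>s\<close> = 0 the second summand vanishes because displacement
  \<open>k + 2\<close> is out of reach.\<close>

lemma walks_binomial: "walks k (int k - 2 * int s) = k choose s"
proof (induction k arbitrary: s)
  case 0
  then show ?case by (cases s) auto
next
  case (Suc k)
  show ?case
  proof (cases s)
    case 0
    then show ?thesis using Suc[of 0] walks_eq_0_if_gt[of k "int k + 2"] by (simp add: add.commute)
  next
    case (Suc t)
    then show ?thesis using Suc.IH[of s] Suc.IH[of t] by (simp add: algebra_simps)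
  qed
qed

lemma walks_le: "walks k d \<le> 2 ^ k"
proof (induction k arbitrary: d)
  case (Suc k)
  show ?case using Suc[of "d - 1"] Suc[of "d + 1"] by simp
qed simp

text \<open>There are 2^k walks of length \<open>k\<close> in all, so the exponential series of
  \<open>2 * x\<close> dominates.\<close>

lemma summable_walks: "summable (\<lambda>k. x ^ k * real (walks k d) / fact k)" if "x \<ge> 0" for x :: real
proof (rule summable_comparison_test_ev)
  have "norm (x ^ k * real (walks k d) / fact k) \<le> inverse (fact k) * (2 * x) ^ k" for k
  proof -
    have "real (walks k d) \<le> 2 ^ k"
      using walks_le[of k d] by (metis of_nat_le_iff of_nat_numeral of_nat_power)
    then have "x ^ k * real (walks k d) \<le> x ^ k * 2 ^ k"
      using that by (intro mult_left_mono) auto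
    then show ?thesis using that
      by (simp add: field_simps power_mult_distrib)
  qed
  then show "\<forall>\<^sub>F k in sequentially.
      norm (x ^ k * real (walks k d) / fact k) \<le> inverse (fact k) * (2 * x) ^ k"
    by simp
  show "summable (\<lambda>k. inverse (fact k) * (2 * x) ^ k)"
    by (rule summable_exp)
qed

text \<open>By distance and parity only the indices \<open>k = d + 2 * s\<close> contribute. There
  the binomial coefficient over \<open>fact k\<close> is \<open>1 / (fact s * fact (d + s))\<close>,
  the Bessel coefficient.\<close>

lemma bessel_I_sums:
  fixes x :: real
  assumes "x \<ge> 0"
  shows "(\<lambda>k. x ^ k * real (walks k (int d)) / fact k) sums bessel_I d (2 * x)"
proof -
  let ?f = "\<lambda>k. x ^ k * real (walks k (int d)) / fact k"
  have mono: "strict_mono (\<lambda>s. d + 2 * s)"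
    by (simp add: strict_mono_def)
  have zero: "?f k = 0" if "k \<notin> range (\<lambda>s. d + 2 * s)" for k
  proof (cases "k < d")
    case True
    then show ?thesis by (simp add: walks_eq_0_if_gt)
  next
    case False
    have "odd (k - d)"
    proof
      assume "even (k - d)"
      then obtain s where "k - d = 2 * s" by (elim evenE)
      then have "k = d + 2 * s" using False by simp
      then show False using that by blast
    qed
    then have "odd (int k + int d)" using False
      by (metis even_diff_nat even_of_nat of_nat_add)
    then show ?thesis by (simp add: walks_eq_0_if_odd)
  qed
  have entry: "?f (d + 2 * s) = 1 / (fact s * fact (d + s)) * (2 * x / 2) ^ (d + 2 * s)" for s
  proof -
    have "walks (d + 2 * s) (int d) = (d + 2 * s) choose s"
      using walks_binomial[of "d + 2 * s" s] by simp
    moreover have "real ((d + 2 * s) choose s) = fact (d + 2 * s) / (fact s * fact (d + s))"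
      using binomial_fact[of s "d + 2 * s", where 'a = real] by (simp add: algebra_simps mult_2)
    ultimately show ?thesis by simp
  qed
  have "?f sums suminf ?f"
    using summable_walks[OF assms] by (rule summable_sums)
  then have "(\<lambda>s. ?f (d + 2 * s)) sums suminf ?f"
    using sums_mono_reindex[OF mono, of ?f "suminf ?f"] zero by blast
  then have "suminf ?f = bessel_I d (2 * x)"
    unfolding bessel_I_def entry by (simp add: sums_iff)
  then show ?thesis
    using \<open>?f sums suminf ?f\<close> by simp
qed

lemma bessel_I_nonneg: "bessel_I d (2 * x) \<ge> 0" if "x \<ge> 0"
  by (rule sums_le[OF _ sums_zero bessel_I_sums[OF that]]) (simp add: that)

lemma tridiag_carrier [simp]: "tridiag n a b c \<in> carrier_mat n n"
  by (simp add: tridiag_def)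

lemma tridiag_dim [simp]: "dim_row (tridiag n a b c) = n" "dim_col (tridiag n a b c) = n"
  by (simp_all add: tridiag_def)

lemma tridiag_pow_Suc_entry:
  assumes "i < n" "j < n"
  shows "(tridiag n a b a ^\<^sub>m Suc k) $$ (i, j) =
    b * (tridiag n a b a ^\<^sub>m k) $$ (i, j)
    + a * ((if 0 < j then (tridiag n a b a ^\<^sub>m k) $$ (i, j - 1) else 0)
         + (if Suc j < n then (tridiag n a b a ^\<^sub>m k) $$ (i, Suc j) else 0))"
proof -
  let ?T = "tridiag n a b a"
  let ?P = "?T ^\<^sub>m k"
  have P: "?P \<in> carrier_mat n n" by (intro pow_carrier_mat) simp
  have "(?T ^\<^sub>m Suc k) $$ (i, j) = (\<Sum>m<n. ?P $$ (i, m) * ?T $$ (m, j))"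
    using assms P by (simp add: scalar_prod_def atLeast0LessThan)
  \<comment> \<open>Subtraction truncates, so \<open>j - 1\<close> is a genuine neighbour only under
    the guard \<open>0 < j\<close>. At the other end \<open>m < n\<close> already excludes
    \<open>m = Suc j\<close> when \<open>Suc j = n\<close>.\<close>
  also have "\<dots> = (\<Sum>m<n. (if m = j then b * ?P $$ (i, j) else 0)
      + ((if m = j - 1 then if 0 < j then a * ?P $$ (i, j - 1) else 0 else 0)
      + (if m = Suc j then a * ?P $$ (i, Suc j) else 0)))"
    using assms by (intro sum.cong) (auto simp: tridiag_def)
  also have "\<dots> = b * ?P $$ (i, j)
    + a * ((if 0 < j then ?P $$ (i, j - 1) else 0) + (if Suc j < n then ?P $$ (i, Suc j) else 0))"
    using assms by (auto simp: sum.distrib algebra_simps)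
  finally show ?thesis .
qed

text \<open>The powers satisfy the recursion of \<open>walks\<close>, with steps off the path
  replaced by 0; the triangle inequality carries the bound through the induction.\<close>

lemma norm_path_pow_le_walks:
  assumes "i < n" "j < n"
  shows "cmod ((tridiag n 1 0 1 ^\<^sub>m k) $$ (i, j)) \<le> real (walks k (int i - int j))"
  using assms(2)
proof (induction k arbitrary: j)
  case 0
  then show ?case using assms(1) by simp
next
  case (Suc k)
  let ?H = "\<lambda>j. (tridiag n 1 0 1 ^\<^sub>m k) $$ (i, j)"
  have 1: "cmod (if 0 < j then ?H (j - 1) else 0) \<le> real (walks k (int i - int j + 1))"
    using Suc.IH[of "j - 1"] Suc.prems by (auto simp: of_nat_diff algebra_simps)
  have 2: "cmod (if Suc j < n then ?H (Suc j) else 0) \<le> real (walks k (int i - int j - 1))"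
    using Suc.IH[of "Suc j"] by (auto simp: algebra_simps)
  show ?case
    unfolding tridiag_pow_Suc_entry[OF assms(1) Suc.prems]
    using norm_triangle_mono[OF 1 2] by (simp add: algebra_simps)
qed

text \<open>The binomial theorem for the commuting summands \<open>b\<close> I and \<open>a\<close>
  H, proved entrywise with the column \<open>j\<close> generalized, since each power refers to the
  neighbouring columns.\<close>

lemma tridiag_pow_binomial:
  assumes "i < n" "j < n"
  shows "(tridiag n a b a ^\<^sub>m k) $$ (i, j) =
    (\<Sum>l\<le>k. of_nat (k choose l) * a ^ l * b ^ (k - l) * (tridiag n 1 0 1 ^\<^sub>m l) $$ (i, j))"
  using assms(2)
proof (induction k arbitrary: j)
  case 0
  then show ?case using assms(1) by simp
next
  case (Suc k)
  let ?H = "\<lambda>l j. (tridiag n 1 0 1 ^\<^sub>m l) $$ (i, j)"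
  let ?c = "\<lambda>l. of_nat (k choose l) * a ^ l * b ^ (k - l)"
  have left: "(if 0 < j then (tridiag n a b a ^\<^sub>m k) $$ (i, j - 1) else 0)
      = (\<Sum>l\<le>k. ?c l * (if 0 < j then ?H l (j - 1) else 0))"
    using Suc.IH[of "j - 1"] Suc.prems by auto
  have right: "(if Suc j < n then (tridiag n a b a ^\<^sub>m k) $$ (i, Suc j) else 0)
      = (\<Sum>l\<le>k. ?c l * (if Suc j < n then ?H l (Suc j) else 0))"
    using Suc.IH[of "Suc j"] by auto
  have step: "?H (Suc l) j = (if 0 < j then ?H l (j - 1) else 0)
      + (if Suc j < n then ?H l (Suc j) else 0)" for l
    using tridiag_pow_Suc_entry[OF assms(1) Suc.prems, of 1 0 l] by simp
  have "(tridiag n a b a ^\<^sub>m Suc k) $$ (i, j)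
      = (\<Sum>l\<le>k. b * (?c l * ?H l j)) + (\<Sum>l\<le>k. a * (?c l * ?H (Suc l) j))"
    unfolding tridiag_pow_Suc_entry[OF assms(1) Suc.prems] left right step Suc.IH[OF Suc.prems]
    by (simp add: sum_distrib_left sum.distrib distrib_left)
  \<comment> \<open>The added term \<open>l = Suc k\<close> is zero because
    \<open>k choose Suc k\<close> is. Splitting off \<open>l = 0\<close> then aligns both sums for
    Pascal's rule.\<close>
  also have "(\<Sum>l\<le>k. b * (?c l * ?H l j))
      = (\<Sum>l\<le>Suc k. of_nat (k choose l) * a ^ l * b ^ (Suc k - l) * ?H l j)"
    by (simp add: Suc_diff_le mult_ac)
  also have "\<dots> = b ^ Suc k * ?H 0 j
      + (\<Sum>l\<le>k. of_nat (k choose Suc l) * a ^ Suc l * b ^ (k - l) * ?H (Suc l) j)"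
    by (subst sum.atMost_Suc_shift) (simp del: pow_mat.simps(2))
  finally show ?case
    by (subst sum.atMost_Suc_shift)
      (simp add: sum.distrib algebra_simps del: pow_mat.simps(2))
qed

lemma mat_exp_tridiag_bound:
  assumes "i < n" "j < n"
  shows "cmod (mat_exp (tridiag n a b a) $$ (i, j))
    \<le> exp (Re b) * bessel_I (nat \<bar>int i - int j\<bar>) (2 * cmod a)"
proof -
  let ?T = "tridiag n a b a"
  let ?d = "nat \<bar>int i - int j\<bar>"
  \<comment> \<open>The terms of the \<open>(i, j)\<close> entry of exp(\<open>a\<close> H).\<close>
  define h where "h l = a ^ l * (tridiag n 1 0 1 ^\<^sub>m l) $$ (i, j) / fact l" for l
  let ?g = "\<lambda>l. cmod a ^ l * real (walks l (int ?d)) / fact l"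
  have h_le: "norm (h l) \<le> ?g l" for l
    using norm_path_pow_le_walks[OF assms, of l]
    by (simp add: h_def norm_mult norm_divide norm_power divide_right_mono mult_left_mono walks_abs)
  have g: "?g sums bessel_I ?d (2 * cmod a)"
    by (rule bessel_I_sums) simp
  have sum_h: "summable (\<lambda>l. norm (h l))"
    by (rule summable_comparison_test'[of ?g 0]) (use g h_le in \<open>simp_all add: sums_iff\<close>)
  \<comment> \<open>Cancelling \<open>fact k\<close> against the binomial coefficient leaves a
    convolution of \<open>h\<close> with the series of \<open>exp b\<close>, so the Cauchy product
    yields the factor \<open>exp b\<close>, of modulus \<open>exp (Re b)\<close>.\<close>
  have "(inverse (fact k) \<cdot>\<^sub>m ?T ^\<^sub>m k) $$ (i, j) =
      (\<Sum>l\<le>k. h l * (b ^ (k - l) /\<^sub>R fact (k - l)))" for k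
  proof -
    have "(inverse (fact k) \<cdot>\<^sub>m ?T ^\<^sub>m k) $$ (i, j) = inverse (fact k) * (?T ^\<^sub>m k) $$ (i, j)"
      using assms by simp
    also have "\<dots> = (\<Sum>l\<le>k. h l * (b ^ (k - l) /\<^sub>R fact (k - l)))"
      unfolding tridiag_pow_binomial[OF assms, of a b k] sum_distrib_left
    proof (rule sum.cong)
      fix l assume "l \<in> {..k}"
      then have "of_nat (k choose l) = (fact k / (fact l * fact (k - l)) :: complex)"
        by (simp add: binomial_fact)
      then show "inverse (fact k) * (of_nat (k choose l) * a ^ l * b ^ (k - l)
          * (tridiag n 1 0 1 ^\<^sub>m l) $$ (i, j)) = h l * (b ^ (k - l) /\<^sub>R fact (k - l))"
        by (simp add: h_def scaleR_conv_of_real divide_inverse)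
    qed simp
    finally show ?thesis .
  qed
  then have "mat_exp ?T $$ (i, j) = (\<Sum>k. \<Sum>l\<le>k. h l * (b ^ (k - l) /\<^sub>R fact (k - l)))"
    using assms by (simp add: mat_exp_def)
  also have "\<dots> = suminf h * exp b"
    unfolding exp_def by (rule Cauchy_product[symmetric, OF sum_h summable_norm_exp])
  finally have "cmod (mat_exp ?T $$ (i, j)) = exp (Re b) * cmod (suminf h)"
    by (simp add: norm_mult)
  also have "cmod (suminf h) \<le> (\<Sum>l. norm (h l))"
    by (rule summable_norm[OF sum_h])
  also have "\<dots> \<le> suminf ?g"
    using g sum_h by (intro suminf_le h_le) (auto simp: sums_iff)
  also have "\<dots> = bessel_I ?d (2 * cmod a)"
    using g by (simp add: sums_iff)
  finally show ?thesis by simp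
qed

theorem theorem4p1:
  fixes a b :: complex and n i j :: nat
  assumes "n \<ge> 1"
    and "i \<in> {1..n}" and "j \<in> {1..n}"
  shows "cmod (mat_exp (tridiag n a b a) $$ (i - 1, j - 1))
    \<le> 2 * exp (Re b) * (cmod a * exp 1 / (real n + 1)) ^ (n + 1)
      + exp (Re b) * (bessel_I (nat \<bar>int i - int j\<bar>) (2 * cmod a)
                      + bessel_I (i + j) (2 * cmod a))"
proof -
  \<comment> \<open>Passing to indices from 0 preserves the difference; \<open>i\<close> and
    \<open>j\<close> are at least 1, so nothing is truncated.\<close>
  have "int (i - 1) - int (j - 1) = int i - int j"
    using assms by (simp add: of_nat_diff)
  then have "cmod (mat_exp (tridiag n a b a) $$ (i - 1, j - 1))
      \<le> exp (Re b) * bessel_I (nat \<bar>int i - int j\<bar>) (2 * cmod a)"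
    using mat_exp_tridiag_bound[of "i - 1" n "j - 1" a b] assms by auto
  moreover have "0 \<le> exp (Re b) * bessel_I (i + j) (2 * cmod a)"
    by (simp add: bessel_I_nonneg)
  moreover have "0 \<le> 2 * exp (Re b) * (cmod a * exp 1 / (real n + 1)) ^ (n + 1)"
    by simp
  ultimately show ?thesis
    unfolding distrib_left by linarith
qed

end
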